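(* Let $q$ be a prime power, let $\mathcal{A}$ be a (central) arrangement of hyperplanes in $\mathbb{F}_q^\ell$, and suppose $\chi(\mathcal{A},t)=\sum_{i=0}^{\ell}c_i\,t_q^{\underline{i}}$. Then $c_i$ is the number of $i$-dimensional linear subspaces of $\mathbb{F}_q^\ell$ that are not contained in any hyperplane in $\mathcal{A}$.
   Context: $\mathbb{F}_q$ is the field with $q$ elements. A central arrangement $\mathcal{A}$ is a finite (possibly empty) collection of linear hyperplanes in a finite dimensional vector space $V$. Its intersection lattice is $L(\mathcal{A})=\{\bigcap_{H\in\mathcal{B}}H \mid \mathcal{B}\subseteq\mathcal{A}\}$ (the empty intersection being $V$), ordered by reverse inclusion, and its characteristic polynomial is $\chi(\mathcal{A},t)=\sum_{X\in L(\mathcal{A})}\mu(X)t^{\dim X}$, where $\mu(X)=\mu(V,X)$ is the Möbius function of $L(\mathcal{A})$. The polynomials $t_q^{\underline{i}}$ are defined by $t_q^{\underline{i}}=(t-1)(t-q)\cdots(t-q^{i-1})$, with $t_q^{\underline{0}}=1$. *)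

theory Defs
  imports
    Complex_Main
    "HOL-Library.Cardinality"
    "HOL-Library.Function_Algebras"
    "HOL-Computational_Algebra.Polynomial"
    "HOL-Number_Theory.Prime_Powers"
begin

text \<open>
  The coordinate space of dimension \<open>l\<close> over the field \<open>'a\<close>: a vector is a sequence whose entries
  from index \<open>l\<close> on vanish. Addition is the pointwise one of the function type.
\<close>

definition seq_scale :: "'a::field \<Rightarrow> (nat \<Rightarrow> 'a) \<Rightarrow> nat \<Rightarrow> 'a" where
  "seq_scale c v = (\<lambda>i. c * v i)"

definition coord_space :: "nat \<Rightarrow> (nat \<Rightarrow> 'a::field) set" where
  "coord_space l = {v. \<forall>i\<ge>l. v i = 0}"

global_interpretation seq_vs: vector_space "seq_scale :: 'a::field \<Rightarrow> (nat \<Rightarrow> 'a) \<Rightarrow> (nat \<Rightarrow> 'a)"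
  by unfold_locales (auto simp: seq_scale_def fun_eq_iff algebra_simps)

lemma subspace_coord_space: "seq_vs.subspace (coord_space l)"
  by (auto simp: seq_vs.subspace_def coord_space_def seq_scale_def)

lemma dim_coord_space: "seq_vs.dim (coord_space l :: (nat \<Rightarrow> 'a::field) set) = l"
proof -
  define e :: "nat \<Rightarrow> nat \<Rightarrow> 'a" where "e k = (\<lambda>i. if i = k then 1 else 0)" for k
  have inj: "inj_on e {..<l}"
    by (auto simp: inj_on_def e_def fun_eq_iff split: if_splits)
  have comb: "(\<Sum>k<l. seq_scale (u k) (e k)) i = (if i < l then u i else 0)" for u i
  proof -
    have "(\<Sum>k\<in>S. seq_scale (u k) (e k)) i = (\<Sum>k\<in>S. if i = k then u k else 0)"
      if "finite S" for S
      using that by (induction S) (auto simp: seq_scale_def e_def)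
    then show ?thesis by simp
  qed
  have indep: "seq_vs.independent (e ` {..<l})"
  proof (rule seq_vs.independent_if_scalars_zero)
    fix f x assume *: "(\<Sum>x\<in>e ` {..<l}. seq_scale (f x) x) = 0" and "x \<in> e ` {..<l}"
    then obtain k where k: "k < l" "x = e k" by auto
    have "(\<Sum>j<l. seq_scale (f (e j)) (e j)) = 0"
      using * by (simp add: sum.reindex[OF inj])
    then have "(\<Sum>j<l. seq_scale (f (e j)) (e j)) k = 0"
      by simp
    then show "f x = 0"
      using comb[of "\<lambda>j. f (e j)" k] k by simp
  qed simp
  have "v \<in> seq_vs.span (e ` {..<l})" if "v \<in> coord_space l" for v
  proof -
    have "v = (\<Sum>k<l. seq_scale (v k) (e k))"
      using that by (auto simp: fun_eq_iff comb coord_space_def)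
    also have "\<dots> \<in> seq_vs.span (e ` {..<l})"
      by (intro seq_vs.span_sum seq_vs.span_scale seq_vs.span_base) auto
    finally show ?thesis .
  qed
  moreover have "e ` {..<l} \<subseteq> coord_space l"
    by (auto simp: e_def coord_space_def)
  ultimately show ?thesis
    using indep card_image[OF inj]
    by (intro seq_vs.dim_unique[of "e ` {..<l}"]) auto
qed

definition linear_hyperplane :: "(nat \<Rightarrow> 'a::field) set \<Rightarrow> (nat \<Rightarrow> 'a::field) set \<Rightarrow> bool" where
  "linear_hyperplane V H \<longleftrightarrow> seq_vs.subspace H \<and> H \<subseteq> V \<and> seq_vs.dim V = seq_vs.dim H + 1"

definition central_arrangement :: "(nat \<Rightarrow> 'a::field) set \<Rightarrow> (nat \<Rightarrow> 'a::field) set set \<Rightarrow> bool" where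
  "central_arrangement V A \<longleftrightarrow> finite A \<and> (\<forall>H\<in>A. linear_hyperplane V H)"

text \<open>Intersecting with \<open>V\<close> only matters for \<open>B = {}\<close>, where it yields \<open>V\<close>.\<close>

definition intersection_lattice :: "'v set \<Rightarrow> 'v set set \<Rightarrow> 'v set set" where
  "intersection_lattice V A = {V \<inter> \<Inter>B |B. B \<subseteq> A}"

text \<open>
  The Moebius function of a finite family \<open>L\<close> of sets ordered by \<^emph>\<open>reverse\<close> inclusion: for
  \<open>X \<supset> Y\<close> the sum runs over the half-open interval from \<open>X\<close> (included) to \<open>Y\<close> (excluded).
\<close>

function moebius :: "'v set set \<Rightarrow> 'v set \<Rightarrow> 'v set \<Rightarrow> int" where
  "moebius L X Y =
    (if finite L \<and> X \<in> L \<and> Y \<in> L \<and> Y \<subseteq> X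
     then if X = Y then 1 else - (\<Sum>Z\<in>{Z \<in> L. Y \<subset> Z \<and> Z \<subseteq> X}. moebius L X Z)
     else 0)"
  by pat_completeness auto
termination
proof (relation "measure (\<lambda>(L, X, Y). card {W \<in> L. Y \<subset> W})")
  fix L :: "'v set set" and X Y Z
  assume "finite L \<and> X \<in> L \<and> Y \<in> L \<and> Y \<subseteq> X" and "Z \<in> {Z \<in> L. Y \<subset> Z \<and> Z \<subseteq> X}"
  then have "card {W \<in> L. Z \<subset> W} < card {W \<in> L. Y \<subset> W}"
    by (intro psubset_card_mono) auto
  then show "((L, X, Z), (L, X, Y)) \<in> measure (\<lambda>(L, X, Y). card {W \<in> L. Y \<subset> W})"
    by simp
qed simp

declare moebius.simps [simp del]

definition characteristic_poly :: "(nat \<Rightarrow> 'a::field) set \<Rightarrow> (nat \<Rightarrow> 'a::field) set set \<Rightarrow> int poly" where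
  "characteristic_poly V A =
    (\<Sum>X\<in>intersection_lattice V A. monom (moebius (intersection_lattice V A) V X) (seq_vs.dim X))"

definition q_falling :: "nat \<Rightarrow> nat \<Rightarrow> int poly" where
  "q_falling q i = (\<Prod>j<i. [:- (int q ^ j), 1:])"

end

theory Submission
  imports Defs
begin

text \<open>
  Over a field with \<open>q\<close> elements, \<open>q_falling q i\<close> evaluated at \<open>q ^ n\<close>, that is
  \<open>\<Prod>j<i. q ^ n - q ^ j\<close>, is the number of independent lists of length \<open>i\<close> in an
  \<open>n\<close>-dimensional space. Each of them spans exactly one \<open>i\<close>-dimensional subspace, and every such
  subspace is spanned by equally many lists, so the number of \<open>i\<close>-dimensional subspaces is the
  Gaussian binomial coefficient (\<open>card_subspaces_of_dim\<close>). Because of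
  \<open>t * q_falling q i = q_falling q (i + 1) + q ^ i * q_falling q i\<close>, the coefficients of \<open>t ^ n\<close> in
  the basis \<open>q_falling q i\<close> satisfy the \<open>q\<close>-Pascal recursion and hence are Gaussian binomial
  coefficients as well (\<open>monom_eq_sum_q_falling\<close>).

  Consequently the coefficient of \<open>q_falling q i\<close> in the characteristic polynomial is the sum over
  all flats \<open>X\<close> of \<open>\<mu> X\<close> times the number of \<open>i\<close>-dimensional subspaces \<open>W \<subseteq> X\<close>. Exchanging the two
  sums, each \<open>W\<close> contributes the sum of \<open>\<mu> X\<close> over the flats \<open>X \<supseteq> W\<close>. These are the flats containing the
  smallest one that contains \<open>W\<close>, so the contribution is \<open>1\<close> if that flat is the whole space, which
  means that \<open>W\<close> lies in no hyperplane, and \<open>0\<close> otherwise (\<open>sum_moebius_flats_containing\<close>).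
  The coefficients are unique because \<open>q_falling q i\<close> is monic of degree \<open>i\<close>.
\<close>

section \<open>Counting subspaces over a finite field\<close>

text \<open>
  Only the field is finite: the space of all sequences, in which the coordinate spaces live, has
  infinite dimension.
\<close>

locale finite_field_vector_space = vector_space scale
  for scale :: "'a::field \<Rightarrow> 'b::ab_group_add \<Rightarrow> 'b" +
  assumes finite_field: "finite (UNIV :: 'a set)"
begin

lemma one_less_card_field: "1 < CARD('a)"
proof -
  have "card {0, 1 :: 'a} \<le> CARD('a)"
    using finite_field by (intro card_mono) auto
  then show ?thesis by simp
qed

text \<open>
  Adding a vector \<open>a\<close> outside the span of \<open>B\<close> multiplies the cardinality by \<open>q\<close>, as every element of
  the new span has a unique decomposition \<open>k *s a + x\<close> with \<open>x\<close> in the span of \<open>B\<close>.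
\<close>

lemma card_span_independent:
  assumes "finite B" "independent B"
  shows "finite (span B) \<and> card (span B) = CARD('a) ^ card B"
  using assms
proof (induction B)
  case empty
  then show ?case by simp
next
  case (insert a B)
  then have a: "a \<notin> span B" and B: "independent B"
    by (auto simp: independent_insert)
  let ?f = "\<lambda>(k, x). scale k a + x"
  have inj: "inj_on ?f (UNIV \<times> span B)"
  proof (rule inj_onI, clarify)
    fix k k' x x'
    assume x: "x \<in> span B" "x' \<in> span B" and eq: "scale k a + x = scale k' a + x'"
    have "scale (k - k') a = x' - x"
      using eq by (simp add: scale_left_diff_distrib algebra_simps)
    then have *: "scale (k - k') a \<in> span B"
      using x by (simp add: span_diff)
    have "k = k'"
    proof (rule ccontr)
      assume "k \<noteq> k'"
      then have "a = scale (inverse (k - k')) (scale (k - k') a)"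
        by simp
      then show False
        using a span_scale[OF *] by metis
    qed
    then show "k = k' \<and> x = x'"
      using eq by simp
  qed
  have im: "span (insert a B) = ?f ` (UNIV \<times> span B)"
  proof (intro set_eqI iffI)
    fix y assume "y \<in> span (insert a B)"
    then obtain k where "y - scale k a \<in> span B"
      by (auto simp: span_insert)
    then have "?f (k, y - scale k a) = y" "(k, y - scale k a) \<in> UNIV \<times> span B"
      by auto
    then show "y \<in> ?f ` (UNIV \<times> span B)"
      by (metis imageI)
  next
    fix y assume "y \<in> ?f ` (UNIV \<times> span B)"
    then obtain k x where "y = scale k a + x" "x \<in> span B"
      by auto
    then have "y - scale k a \<in> span B"
      by simp
    then show "y \<in> span (insert a B)"
      by (auto simp: span_insert)
  qed
  show ?case
    using insert B finite_field by (simp add: im card_image[OF inj] card_cartesian_product)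
qed

lemma card_subspace:
  assumes "subspace S" "finite S"
  shows "card S = CARD('a) ^ dim S"
proof -
  obtain B where B: "B \<subseteq> S" "independent B" "S \<subseteq> span B" "card B = dim S"
    using basis_exists by blast
  moreover have "span B = S"
    using B assms(1) by (simp add: span_minimal subset_antisym)
  ultimately show ?thesis
    using card_span_independent[of B] assms(2) finite_subset by metis
qed

definition indep_lists :: "'b set \<Rightarrow> nat \<Rightarrow> 'b list set" where
  "indep_lists S n = {xs. set xs \<subseteq> S \<and> length xs = n \<and> distinct xs \<and> independent (set xs)}"

lemma finite_indep_lists: "finite S \<Longrightarrow> finite (indep_lists S n)"
  unfolding indep_lists_def
  by (rule finite_subset[OF _ finite_lists_length_eq[of S n]]) auto

text \<open>
  An independent list of length \<open>n\<close> can be extended by any vector outside its span, and that span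
  has \<open>q ^ n\<close> elements. If the length exceeds the dimension, there are no such lists and the product
  contains the factor \<open>0\<close>; integers avoid truncated subtraction beyond that factor.
\<close>

lemma card_indep_lists:
  assumes "subspace S" "finite S"
  shows "int (card (indep_lists S n)) = (\<Prod>j<n. int CARD('a) ^ dim S - int CARD('a) ^ j)"
proof (induction n)
  case 0
  have "indep_lists S 0 = {[]}"
    by (auto simp: indep_lists_def independent_empty)
  then show ?case by simp
next
  case (Suc n)
  let ?q = "int CARD('a)"
  let ?D = "SIGMA xs : indep_lists S n. S - span (set xs)"
  have "indep_lists S (Suc n) = (\<lambda>(xs, x). x # xs) ` ?D"
  proof (intro set_eqI iffI)
    fix ys assume "ys \<in> indep_lists S (Suc n)"
    then show "ys \<in> (\<lambda>(xs, x). x # xs) ` ?D"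
      by (cases ys) (auto simp: indep_lists_def independent_insert image_iff)
  qed (auto simp: indep_lists_def dest: span_base independent_insertI)
  then have "card (indep_lists S (Suc n)) = card ?D"
    by (simp add: card_image inj_on_def)
  also have "\<dots> = (\<Sum>xs\<in>indep_lists S n. card (S - span (set xs)))"
    using assms(2) finite_indep_lists by (intro card_SigmaI) auto
  also have "int \<dots> = (\<Sum>xs\<in>indep_lists S n. ?q ^ dim S - ?q ^ n)"
    unfolding of_nat_sum
  proof (rule sum.cong)
    fix xs assume xs: "xs \<in> indep_lists S n"
    then have sub: "span (set xs) \<subseteq> S"
      using assms(1) by (simp add: indep_lists_def span_minimal)
    have "card (span (set xs)) = CARD('a) ^ n"
      using xs card_span_independent[of "set xs"]
      by (simp add: indep_lists_def distinct_card)
    moreover have "card (S - span (set xs)) = card S - card (span (set xs))"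
      using sub assms(2) finite_subset by (intro card_Diff_subset) auto
    moreover have "card (span (set xs)) \<le> card S"
      using sub assms(2) by (rule card_mono[rotated])
    ultimately show "int (card (S - span (set xs))) = ?q ^ dim S - ?q ^ n"
      using card_subspace[OF assms] by (simp add: of_nat_diff)
  qed simp
  finally show ?case
    using Suc by simp
qed

text \<open>The span of \<open>B\<close> is contained in the finite set \<open>W\<close> and has as many elements.\<close>

lemma span_eq_if_card_eq_dim:
  assumes "subspace W" "finite W"
    and "B \<subseteq> W" "independent B" "card B = dim W"
  shows "span B = W"
proof (rule card_subset_eq[OF assms(2)])
  show "span B \<subseteq> W"
    using assms by (simp add: span_minimal)
  show "card (span B) = card W"
    using card_span_independent[of B] card_subspace[OF assms(1,2)] assms finite_subset
    by metis
qed

lemma dim_mono_finite_subspaces: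
  assumes "subspace S" "finite S" "subspace W" "W \<subseteq> S"
  shows "dim W \<le> dim S"
proof -
  have "CARD('a) ^ dim W \<le> CARD('a) ^ dim S"
    using card_subspace assms card_mono finite_subset by metis
  then show ?thesis
    using one_less_card_field by (simp add: power_increasing_iff)
qed

text \<open>
  Double counting of the independent lists of length \<open>i\<close> in \<open>S\<close>: each lies in exactly one subspace
  of dimension \<open>i\<close>, its span.
\<close>

lemma card_subspaces_mult:
  assumes "subspace S" "finite S"
  shows "int (card {W. subspace W \<and> W \<subseteq> S \<and> dim W = i}) * (\<Prod>j<i. int CARD('a) ^ i - int CARD('a) ^ j)
    = (\<Prod>j<i. int CARD('a) ^ dim S - int CARD('a) ^ j)"
proof -
  let ?F = "{W. subspace W \<and> W \<subseteq> S \<and> dim W = i}"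
  have span: "span (set xs) = W" if "W \<in> ?F" "xs \<in> indep_lists W i" for W xs
    using that assms(2) finite_subset span_eq_if_card_eq_dim[of W "set xs"]
    by (auto simp: indep_lists_def distinct_card)
  have "indep_lists S i = (\<Union>W\<in>?F. indep_lists W i)"
  proof (intro set_eqI iffI)
    fix xs assume xs: "xs \<in> indep_lists S i"
    then have "span (set xs) \<in> ?F"
      using assms(1) dim_span_eq_card_independent[of "set xs"]
      by (auto simp: indep_lists_def span_minimal distinct_card)
    moreover have "xs \<in> indep_lists (span (set xs)) i"
      using xs by (auto simp: indep_lists_def span_base)
    ultimately show "xs \<in> (\<Union>W\<in>?F. indep_lists W i)"
      by blast
  qed (auto simp: indep_lists_def)
  also have "card \<dots> = (\<Sum>W\<in>?F. card (indep_lists W i))"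
  proof (rule card_UN_disjoint)
    show "finite ?F"
      using assms(2) by (intro finite_subset[OF _ finite_Collect_subsets]) auto
    show "\<forall>W\<in>?F. finite (indep_lists W i)"
      using assms(2) finite_subset finite_indep_lists by blast
    show "\<forall>W\<in>?F. \<forall>W'\<in>?F. W \<noteq> W' \<longrightarrow> indep_lists W i \<inter> indep_lists W' i = {}"
      using span by blast
  qed
  also have "int \<dots> = (\<Sum>W\<in>?F. \<Prod>j<i. int CARD('a) ^ i - int CARD('a) ^ j)"
    unfolding of_nat_sum
  proof (rule sum.cong)
    fix W assume "W \<in> ?F"
    then show "int (card (indep_lists W i)) = (\<Prod>j<i. int CARD('a) ^ i - int CARD('a) ^ j)"
      using card_indep_lists[of W i] finite_subset[OF _ assms(2)] by simp
  qed simp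
  finally show ?thesis
    using card_indep_lists[OF assms, of i] by simp
qed

end

section \<open>Gaussian binomial coefficients\<close>

text \<open>
  The Gaussian binomial coefficients, defined by the \<open>q\<close>-Pascal recursion instead of the usual
  quotient of products: the recursion gives the expansion of \<open>t ^ n\<close>, and the quotient formula
  becomes the division-free identity \<open>gauss_binomial_mult\<close>.
\<close>

fun gauss_binomial :: "nat \<Rightarrow> nat \<Rightarrow> nat \<Rightarrow> int" where
  "gauss_binomial q n 0 = 1"
| "gauss_binomial q 0 (Suc i) = 0"
| "gauss_binomial q (Suc n) (Suc i) =
    int q ^ Suc i * gauss_binomial q n (Suc i) + gauss_binomial q n i"

lemma gauss_binomial_eq_0: "n < i \<Longrightarrow> gauss_binomial q n i = 0"
  by (induction q n i rule: gauss_binomial.induct) auto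

lemma prod_power_diff_Suc:
  fixes x :: "'a::comm_ring_1"
  shows "(\<Prod>j<Suc i. x ^ Suc n - x ^ j) = (x ^ Suc n - 1) * x ^ i * (\<Prod>j<i. x ^ n - x ^ j)"
proof -
  have "(\<Prod>j<Suc i. x ^ Suc n - x ^ j) = (x ^ Suc n - 1) * (\<Prod>j<i. x ^ Suc n - x ^ Suc j)"
    by (simp add: prod.lessThan_Suc_shift del: prod.lessThan_Suc)
  also have "(\<Prod>j<i. x ^ Suc n - x ^ Suc j) = (\<Prod>j<i. x * (x ^ n - x ^ j))"
    by (simp add: algebra_simps)
  finally show ?thesis
    by (simp add: prod.distrib mult.assoc)
qed

lemma gauss_binomial_mult:
  "gauss_binomial q n i * (\<Prod>j<i. int q ^ i - int q ^ j) = (\<Prod>j<i. int q ^ n - int q ^ j)"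
proof (induction q n i rule: gauss_binomial.induct)
  case (2 q i)
  \<comment> \<open>On the right, the factor for \<open>j = 0\<close> vanishes.\<close>
  show ?case
    by (simp add: prod.lessThan_Suc_shift del: prod.lessThan_Suc)
next
  case (3 q n i)
  let ?x = "int q"
  let ?P = "\<lambda>n i. \<Prod>j<i. ?x ^ n - ?x ^ j"
  have "gauss_binomial q (Suc n) (Suc i) * ?P (Suc i) (Suc i)
      = ?x ^ Suc i * (gauss_binomial q n (Suc i) * ?P (Suc i) (Suc i))
        + (?x ^ Suc i - 1) * ?x ^ i * (gauss_binomial q n i * ?P i i)"
    unfolding gauss_binomial.simps distrib_right prod_power_diff_Suc[of ?x i i]
    by (simp only: ac_simps)
  also have "\<dots> = ?x ^ Suc i * ?P n (Suc i) + (?x ^ Suc i - 1) * ?x ^ i * ?P n i"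
    by (simp only: 3)
  also have "\<dots> = (?x ^ Suc n - 1) * ?x ^ i * ?P n i"
    by (simp add: algebra_simps)
  finally show ?case
    by (simp only: prod_power_diff_Suc)
qed simp

lemma (in finite_field_vector_space) card_subspaces_of_dim:
  assumes "subspace S" "finite S"
  shows "int (card {W. subspace W \<and> W \<subseteq> S \<and> dim W = i}) = gauss_binomial CARD('a) (dim S) i"
proof -
  have "int CARD('a) ^ i - int CARD('a) ^ j \<noteq> 0" if "j < i" for j
    using that one_less_card_field by simp
  then have nz: "(\<Prod>j<i. int CARD('a) ^ i - int CARD('a) ^ j) \<noteq> 0"
    by simp
  show ?thesis
    by (rule mult_right_cancel[OF nz, THEN iffD1])
      (simp only: card_subspaces_mult[OF assms] gauss_binomial_mult)
qed

section \<open>The basis of \<open>q\<close>-falling factorials\<close>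

lemma degree_q_falling [simp]: "degree (q_falling q i) = i"
  and lead_coeff_q_falling [simp]: "coeff (q_falling q i) i = 1"
proof -
  show *: "degree (q_falling q i) = i"
    unfolding q_falling_def by (subst degree_prod_eq_sum_degree) auto
  have "lead_coeff (q_falling q i) = 1"
    unfolding q_falling_def by (subst lead_coeff_prod) auto
  then show "coeff (q_falling q i) i = 1"
    by (simp add: *)
qed

lemma q_falling_Suc:
  "q_falling q (Suc i) = [:0, 1:] * q_falling q i - smult (int q ^ i) (q_falling q i)"
  by (simp add: q_falling_def algebra_simps)

lemma smult_sum_right: "smult c (\<Sum>i\<in>I. p i) = (\<Sum>i\<in>I. smult c (p i))"
  by (induction I rule: infinite_finite_induct) (simp_all add: smult_add_right)

text \<open>
  Multiplication by \<open>t\<close> replaces \<open>q_falling q i\<close> by \<open>q_falling q (i + 1) + q ^ i * q_falling q i\<close>;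
  collecting equal indices yields the \<open>q\<close>-Pascal recursion. The terms with \<open>i > n\<close> are \<open>0\<close>, and
  including them gives one common range for flats of all dimensions.
\<close>

lemma monom_eq_sum_q_falling:
  assumes "n \<le> m"
  shows "monom 1 n = (\<Sum>i=0..m. smult (gauss_binomial q n i) (q_falling q i))"
proof -
  have "monom 1 n = (\<Sum>i=0..n. smult (gauss_binomial q n i) (q_falling q i))"
  proof (induction n)
    case 0
    then show ?case
      by (simp add: q_falling_def)
  next
    case (Suc n)
    let ?g = "gauss_binomial q" and ?f = "q_falling q"
    have "monom 1 (Suc n) = [:0, 1:] * (\<Sum>i=0..n. smult (?g n i) (?f i))"
      using Suc by (simp add: monom_Suc)
    also have "\<dots> = (\<Sum>i=0..n. smult (?g n i) (?f (Suc i)) + smult (int q ^ i * ?g n i) (?f i))"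
      unfolding sum_distrib_left q_falling_Suc
      by (intro sum.cong) (auto simp: smult_diff_right mult.commute)
    also have "\<dots> = (\<Sum>i=0..n. smult (?g n i) (?f (Suc i)))
        + (\<Sum>i=0..Suc n. smult (int q ^ i * ?g n i) (?f i))"
      by (simp add: sum.distrib gauss_binomial_eq_0)
    also have "(\<Sum>i=0..Suc n. smult (int q ^ i * ?g n i) (?f i))
        = ?f 0 + (\<Sum>i=0..n. smult (int q ^ Suc i * ?g n (Suc i)) (?f (Suc i)))"
      by (subst sum.atLeast0_atMost_Suc_shift) (simp del: power_Suc)
    also have "(\<Sum>i=0..n. smult (?g n i) (?f (Suc i))) + \<dots>
        = ?f 0 + (\<Sum>i=0..n. smult (?g (Suc n) (Suc i)) (?f (Suc i)))"
      by (simp add: sum.distrib smult_add_left del: power_Suc)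
    also have "\<dots> = (\<Sum>i=0..Suc n. smult (?g (Suc n) i) (?f i))"
      by (subst sum.atLeast0_atMost_Suc_shift) (simp del: gauss_binomial.simps(3))
    finally show ?case .
  qed
  also have "\<dots> = (\<Sum>i=0..m. smult (gauss_binomial q n i) (q_falling q i))"
    using assms by (intro sum.mono_neutral_left) (auto simp: gauss_binomial_eq_0)
  finally show ?thesis .
qed

text \<open>
  The term \<open>q_falling q n\<close> is the only one of degree \<open>n\<close>, so its coefficient vanishes first, and the
  others follow by descending degree.
\<close>

lemma sum_q_falling_eq_0:
  assumes "(\<Sum>i=0..n. smult (c i) (q_falling q i)) = 0" "i \<le> n"
  shows "c i = 0"
  using assms
proof (induction n)
  case 0
  then show ?case
    by (simp add: q_falling_def)
next
  case (Suc n)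
  have "coeff (\<Sum>i=0..n. smult (c i) (q_falling q i)) (Suc n) = 0"
    unfolding coeff_sum by (intro sum.neutral) (auto simp: coeff_eq_0)
  then have "c (Suc n) = 0"
    using arg_cong[OF Suc.prems(1), of "\<lambda>p. coeff p (Suc n)"] by simp
  then show ?case
    using Suc by (cases "i = Suc n") auto
qed

lemma sum_q_falling_unique:
  assumes "(\<Sum>i=0..n. smult (c i) (q_falling q i)) = (\<Sum>i=0..n. smult (d i) (q_falling q i))"
    and "i \<le> n"
  shows "c i = d i"
  using sum_q_falling_eq_0[of "\<lambda>i. c i - d i" q n i] assms
  by (simp add: smult_diff_left sum_subtractf)

section \<open>Moebius sums over flats\<close>

lemma finite_intersection_lattice: "finite A \<Longrightarrow> finite (intersection_lattice V A)"
  unfolding intersection_lattice_def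
  by (rule finite_surj[of "Pow A" _ "\<lambda>B. V \<inter> \<Inter>B"]) auto

text \<open>
  The recursion defining the Moebius function says that its values over the interval from \<open>V\<close> to
  \<open>Y \<noteq> V\<close> add up to \<open>0\<close>.
\<close>

lemma sum_moebius_above:
  assumes "finite L" "V \<in> L" "Y \<in> L" "Y \<subseteq> V" "\<And>X. X \<in> L \<Longrightarrow> X \<subseteq> V"
  shows "(\<Sum>X | X \<in> L \<and> Y \<subseteq> X. moebius L V X) = (if Y = V then 1 else 0)"
proof -
  let ?M = "{X \<in> L. Y \<subset> X \<and> X \<subseteq> V}"
  have "{X. X \<in> L \<and> Y \<subseteq> X} = insert Y ?M"
    using assms by blast
  then have "(\<Sum>X | X \<in> L \<and> Y \<subseteq> X. moebius L V X) = moebius L V Y + (\<Sum>X\<in>?M. moebius L V X)"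
    using assms(1) by simp
  also have "\<dots> = (if Y = V then 1 else 0)"
  proof (cases "Y = V")
    case True
    then have "?M = {}" by blast
    then show ?thesis
      unfolding \<open>?M = {}\<close> using True assms moebius.simps[of L V V] by simp
  next
    case False
    then show ?thesis
      using assms moebius.simps[of L V Y] by auto
  qed
  finally show ?thesis .
qed

text \<open>
  The flats containing \<open>W\<close> are exactly those containing the smallest such flat
  \<open>V \<inter> \<Inter>{H \<in> A. W \<subseteq> H}\<close>, which is \<open>V\<close> just when no hyperplane contains \<open>W\<close>.
\<close>

lemma sum_moebius_flats_containing:
  assumes "finite A" "\<And>H. H \<in> A \<Longrightarrow> H \<subset> V" "W \<subseteq> V"
  defines "L \<equiv> intersection_lattice V A"
  shows "(\<Sum>X | X \<in> L \<and> W \<subseteq> X. moebius L V X) = (if \<forall>H\<in>A. \<not> W \<subseteq> H then 1 else 0)"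
proof -
  define Y where "Y = V \<inter> \<Inter>{H \<in> A. W \<subseteq> H}"
  have "W \<subseteq> X \<longleftrightarrow> Y \<subseteq> X" if "X \<in> L" for X
    using that assms(3) unfolding Y_def L_def intersection_lattice_def by blast
  then have "{X. X \<in> L \<and> W \<subseteq> X} = {X. X \<in> L \<and> Y \<subseteq> X}"
    by blast
  moreover have "Y \<in> L" "V \<in> L" "\<And>X. X \<in> L \<Longrightarrow> X \<subseteq> V"
    unfolding Y_def L_def intersection_lattice_def by blast+
  moreover have "Y = V \<longleftrightarrow> (\<forall>H\<in>A. \<not> W \<subseteq> H)"
    using assms(2) unfolding Y_def by blast
  ultimately show ?thesis
    using sum_moebius_above[of L V Y] finite_intersection_lattice[OF assms(1)]
    by (simp add: L_def)
qed

section \<open>The characteristic polynomial\<close>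

lemma finite_coord_space: "finite (coord_space l :: (nat \<Rightarrow> 'a::{field,finite}) set)"
proof -
  have "finite {v. \<forall>i. (i \<in> {..<l} \<longrightarrow> v i \<in> (UNIV :: 'a set)) \<and> (i \<notin> {..<l} \<longrightarrow> v i = 0)}"
    by (rule finite_set_of_finite_funs) simp_all
  then show ?thesis
    by (simp add: coord_space_def not_less)
qed

lemma subspace_intersection_lattice:
  assumes "central_arrangement V A" "seq_vs.subspace V" "X \<in> intersection_lattice V A"
  shows "seq_vs.subspace X"
  using assms unfolding central_arrangement_def linear_hyperplane_def intersection_lattice_def
  by (auto intro!: seq_vs.subspace_inter seq_vs.subspace_Inter)

theorem proposition1p4:
  fixes q l :: nat
    and A :: "(nat \<Rightarrow> 'a::{field,finite}) set set"
    and c :: "nat \<Rightarrow> int"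
  assumes "primepow q"
    and "CARD('a) = q"
    and "central_arrangement (coord_space l) A"
    and "characteristic_poly (coord_space l) A = (\<Sum>i=0..l. smult (c i) (q_falling q i))"
  shows "\<forall>i\<in>{0..l}. c i = int (card {W. seq_vs.subspace W \<and> W \<subseteq> coord_space l \<and>
            seq_vs.dim W = i \<and> (\<forall>H\<in>A. \<not> W \<subseteq> H)})"
proof
  fix i assume i: "i \<in> {0..l}"
  interpret fin_vs: finite_field_vector_space "seq_scale :: 'a \<Rightarrow> _"
    by unfold_locales simp
  define V where "V = (coord_space l :: (nat \<Rightarrow> 'a) set)"
  define L where "L = intersection_lattice V A"
  let ?\<mu> = "moebius L V"
  let ?S = "\<lambda>X i. {W. seq_vs.subspace W \<and> W \<subseteq> X \<and> seq_vs.dim W = i}"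
  have V: "finite V" "seq_vs.subspace V" "seq_vs.dim V = l"
    by (simp_all add: V_def finite_coord_space subspace_coord_space dim_coord_space)
  have A_V: "H \<subset> V" if "H \<in> A" for H
    using assms(3) that by (auto simp: central_arrangement_def linear_hyperplane_def V_def)
  have A: "finite A"
    using assms(3) by (simp add: central_arrangement_def)
  have L: "finite L"
    using A by (simp add: L_def finite_intersection_lattice)
  have X: "seq_vs.subspace X" "X \<subseteq> V" "finite X" "seq_vs.dim X \<le> l" if "X \<in> L" for X
  proof -
    show "seq_vs.subspace X"
      using assms(3) V(2) that unfolding L_def V_def by (rule subspace_intersection_lattice)
    show "X \<subseteq> V"
      using that by (auto simp: L_def intersection_lattice_def)
    then show "finite X"
      using V(1) finite_subset by blast
    show "seq_vs.dim X \<le> l"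
      using fin_vs.dim_mono_finite_subspaces[of V X] V \<open>seq_vs.subspace X\<close> \<open>X \<subseteq> V\<close> by simp
  qed
  have card_S: "int (card (?S X i)) = gauss_binomial q (seq_vs.dim X) i" if "X \<in> L" for X i
    using fin_vs.card_subspaces_of_dim[of X i] X[OF that] assms(2) by simp
  have "characteristic_poly V A = (\<Sum>X\<in>L. smult (?\<mu> X) (monom 1 (seq_vs.dim X)))"
    by (simp add: characteristic_poly_def L_def smult_monom)
  also have "\<dots> = (\<Sum>X\<in>L. \<Sum>i=0..l. smult (?\<mu> X * int (card (?S X i))) (q_falling q i))"
    by (intro sum.cong refl)
      (simp add: monom_eq_sum_q_falling[OF X(4), of _ q] card_S smult_sum_right)
  also have "\<dots> = (\<Sum>i=0..l. smult (\<Sum>X\<in>L. ?\<mu> X * int (card (?S X i))) (q_falling q i))"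
    by (subst sum.swap) (simp add: smult_sum)
  finally have "c i = (\<Sum>X\<in>L. ?\<mu> X * int (card (?S X i)))"
    using sum_q_falling_unique[of c q l _ i] assms(4) i by (simp add: V_def)
  \<comment> \<open>The number of subspaces of \<open>X\<close> is written as a sum over those of \<open>V\<close>, to exchange it with
    the sum over the flats.\<close>
  also have "\<dots> = (\<Sum>X\<in>L. \<Sum>W | W \<in> ?S V i \<and> W \<subseteq> X. ?\<mu> X)"
  proof (rule sum.cong)
    fix X assume "X \<in> L"
    then have "{W. W \<in> ?S V i \<and> W \<subseteq> X} = ?S X i"
      using X(2) by blast
    then show "?\<mu> X * int (card (?S X i)) = (\<Sum>W | W \<in> ?S V i \<and> W \<subseteq> X. ?\<mu> X)"
      by simp
  qed simp
  also have "\<dots> = (\<Sum>W\<in>?S V i. \<Sum>X | X \<in> L \<and> W \<subseteq> X. ?\<mu> X)"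
    using L V(1) by (intro sum.swap_restrict) (auto intro: finite_subset[of _ "Pow V"])
  also have "\<dots> = (\<Sum>W\<in>?S V i. if \<forall>H\<in>A. \<not> W \<subseteq> H then 1 else 0)"
    using sum_moebius_flats_containing[OF A A_V] by (intro sum.cong refl) (simp add: L_def)
  also have "\<dots> = int (card {W \<in> ?S V i. \<forall>H\<in>A. \<not> W \<subseteq> H})"
    using V(1) by (simp add: sum.If_cases Int_def)
  also have "{W \<in> ?S V i. \<forall>H\<in>A. \<not> W \<subseteq> H} = {W. seq_vs.subspace W \<and> W \<subseteq> V \<and>
      seq_vs.dim W = i \<and> (\<forall>H\<in>A. \<not> W \<subseteq> H)}"
    by blast
  finally show "c i = int (card {W. seq_vs.subspace W \<and> W \<subseteq> coord_space l \<and>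
            seq_vs.dim W = i \<and> (\<forall>H\<in>A. \<not> W \<subseteq> H)})"
    by (simp add: V_def)
qed

end
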